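(* Consider the closed-loop multi-agent system described in the context (agents, attacked outputs, observers, dynamic event-triggered mechanism and adaptive controller), with control gain $K=B^TP$ and $\Gamma=PBB^TP$. Assume: (A1) the union graph $\mathcal G_{\rm un}$ of the $s$ undirected graphs is undirected and connected; (A2) $\mathcal G(t)$ switches among the $s$ undirected graphs according to a continuous-time ergodic Markov process $\sigma(t)$ with transition rate matrix $\Upsilon$ (whose distribution is the invariant distribution $\Pi$ for all $t\ge0$); (A3) the attack signals satisfy $\|\varepsilon(t)\|^2\le\tau$, with $\tau>0$ a known constant; and that the positive scalars $c,\eta_i,\iota_i,\varsigma_i$, $o_i\in(0,1)$, $\kappa,\chi$ and the positive definite matrices $P,Q\in\mathbb R^{n\times n}$ satisfy $$\Lambda+\kappa\tilde\Theta<0,\quad \chi I-\hat\Theta<0,\quad \rho-\varsigma_i>0,\quad \eta_i-\frac{\rho-\varsigma_i}{\iota_i}>0,\quad \bar d_i>4c+o_i+1,\quad \upsilon_i\ge\frac1\rho\qquad(i=1,\dots,N),$$ where $$\Lambda=\begin{pmatrix}\Pi_{\min}\left(A^TP+PA-\frac cs\lambda_2(\hat{\mathcal L})\Gamma\right)&0\\0&\Psi\end{pmatrix},\quad \tilde\Theta=\begin{pmatrix}P&0\\0&Q\end{pmatrix},\quad \hat\Theta=\begin{pmatrix}\lambda_2(\hat{\mathcal L})P&0\\0&Q\end{pmatrix},$$ $$\Psi=\frac1s\Big(A^TQ+QA-QGC-(QGC)^T+\lambda_M(FF^T)QGG^TQ^T+s(2c+\bar d^2)\Pi_{\max}\lambda_M^2(\hat{\mathcal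 L})\Gamma\Big),$$ $\hat{\mathcal L}=\sum_{p=1}^s\mathcal L(p)$, $\lambda_2(\hat{\mathcal L})$ is its second smallest eigenvalue, $\lambda_M(\cdot)$ denotes the largest eigenvalue, $\Pi_{\max}=\max_p\Pi_p$, $\Pi_{\min}=\min_p\Pi_p$, $\bar d=\max_i\bar d_i$, $\tilde c=\max_i\{\bar d_i+4c\}$ and $\rho=\tilde c\,\Pi_{\max}N(N^2+N)$. Then Zeno behavior of the multi-agent system (infinitely many triggering instants of an agent in a finite time interval) is eliminated under this observer-based distributed secure controller, and a minimum time interval between consecutive events is ensured.
   Context: Agents. There are $N$ agents with dynamics $\dot x_i=Ax_i+Bu_i$, $y_i=Cx_i$, $x_i\in\mathbb R^n$, $u_i\in\mathbb R^m$, $y_i\in\mathbb R^{n_y}$, with $A,B,C$ constant real matrices of compatible dimensions. Graphs. $\mathcal G_1,\dots,\mathcal G_s$ are undirected graphs on the vertex set $\{1,\dots,N\}$ with $0/1$ adjacency matrices $[a_{ij}(p)]$ and Laplacians $\mathcal L(p)$ (with $l_{ij}=-a_{ij}$ for $i\ne j$ and $l_{ii}=\sum_j a_{ij}$). The communication graph is $\mathcal G(t)=\mathcal G_{\sigma(t)}$, where $\sigma(t)\in\{1,\dots,s\}$ is a continuous-time Markov process with generator (transition rate matrix) $\Upsilon$, $\Upsilon\mathbf 1=0$. $\Pi=[\Pi_1,\dots,\Pi_s]^T$ is its invariant distribution: $\Pi^T\Upsilon=0$, $\Pi^T\mathbf 1=1$, $\Pi_p\ge0$. The union graph $\mathcal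 G_{\rm un}$ has edge set equal to the union of the edge sets of the $\mathcal G_p$. Individual graphs $\mathcal G_p$ may be disconnected. Deception attacks. The attacked output of agent $i$ is $\breve y_i(t)=y_i(t)+\alpha_i(t)\varepsilon_i(t)$, where $\varepsilon_i$ is the attack signal and $\alpha_i(t)\in\{0,1\}$ is a Bernoulli random variable with known probability $\mathrm{prob}\{\alpha_i(t)=1\}=\bar\alpha_i$. Put $\varepsilon=[\varepsilon_1^T,\dots,\varepsilon_N^T]^T$ and $F=\mathrm{diag}\{\bar\alpha_1,\dots,\bar\alpha_N\}$. Observer. $\dot{\hat x}_i=A\hat x_i+Bu_i+G(\breve y_i-C\hat x_i)$, with observer gain $G\in\mathbb R^{n\times n_y}$. Event-triggered mechanism. Agent $i$ has triggering instants $t_1^i=0<t_2^i<\cdots$; $t_k^i$ denotes the latest triggering instant of agent $i$ (and $t_k^j$ that of agent $j$). Set $m_i(t)=\hat x_i(t_k^i)-\hat x_i(t)$. The relative state error between neighboring agents at the event-triggered instant is $\tilde\xi_i(t)=\xi_i(t_k^i)$ for $t\in[t_k^i,t_{k+1}^i)$, where $\xi_i(t_k^i)=\sum_{j=1}^N a_{ij}(\sigma(t_k^i))\big(\hat x_j(t_k^j)-\hat x_i(t_k^i)\big)$. The next instant is $$t_{k+1}^i=\inf\big\{t>t_k^i:\ \iota_i\big(m_i^T(t)\Gamma m_i(t)-o_i\upsilon_i\tilde\xi_i^T(t)\Gamma\tilde\xi_i(t)\big)\ge\varpi_i(t)\big\},$$ where $\Gamma=PBB^TP$, $o_i\in(0,1)$,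 $\upsilon_i,\iota_i>0$, and the threshold $\varpi_i$ satisfies $$\dot\varpi_i=-\eta_i\varpi_i+\varsigma_i\big[o_i\upsilon_i\tilde\xi_i^T\Gamma\tilde\xi_i-m_i^T\Gamma m_i\big],\quad \varpi_i(0)>0,\ \eta_i>0,\ \varsigma_i>0.$$ Controller. $u_i(t)=d_i(t)K\sum_{j=1}^N a_{ij}(\sigma(t))\big(\hat x_j(t_k^j)-\hat x_i(t_k^i)\big)$ for $t\in[t_k^i,t_{k+1}^i)$, where $\dot d_i=\beta_i\tilde\xi_i^T\Gamma\tilde\xi_i$ if $d_i<\bar d_i$ and $\dot d_i=0$ if $d_i\ge\bar d_i$, with constants $\beta_i,\bar d_i>0$ and $1<d_i(0)<\bar d_i$. Matrix inequalities are in the sense of symmetric definiteness.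
   Formalization: The minimum time interval between consecutive events is established on every finite time window [0,b], with a bound that may depend on b; a single bound valid for all t≥0 can fail under the stated hypotheses. *)

theory Defs
  imports "HOL-Probability.Probability" "HOL-Computational_Algebra.Computational_Algebra"
begin

section \<open>Real matrices\<close>

definition quad :: "real^'n^'n \<Rightarrow> real^'n \<Rightarrow> real" where
  "quad M v = v \<bullet> (M *v v)"

definition pos_def :: "real^'n^'n \<Rightarrow> bool" where
  "pos_def M \<longleftrightarrow> transpose M = M \<and> (\<forall>v. v \<noteq> 0 \<longrightarrow> 0 < quad M v)"

definition neg_def :: "real^'n^'n \<Rightarrow> bool" where
  "neg_def M \<longleftrightarrow> pos_def (- M)"

definition block_diag :: "real^'a^'a \<Rightarrow> real^'b^'b \<Rightarrow> real^('a + 'b)^('a + 'b)" where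
  "block_diag X Y = (\<chi> i j. case (i, j) of
      (Inl a, Inl b) \<Rightarrow> X $ a $ b
    | (Inr a, Inr b) \<Rightarrow> Y $ a $ b
    | _ \<Rightarrow> 0)"

definition diag_mat :: "('n \<Rightarrow> real) \<Rightarrow> real^'n^'n" where
  "diag_mat f = (\<chi> i j. if i = j then f i else 0)"

definition charpoly :: "real^'n^'n \<Rightarrow> real poly" where
  "charpoly M = det (\<chi> i j. (if i = j then [:0, 1:] else 0) - [:M $ i $ j:])"

text \<open>The real eigenvalues in increasing order, repeated according to algebraic multiplicity.
  All uses below are for real symmetric matrices, whose eigenvalues are all real.\<close>

definition eigenvals :: "real^'n^'n \<Rightarrow> real list" where
  "eigenvals M = sorted_list_of_multiset (proots (charpoly M))"

definition lambda2 :: "real^'n^'n \<Rightarrow> real" where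
  "lambda2 M = eigenvals M ! 1"

definition lambda_max :: "real^'n^'n \<Rightarrow> real" where
  "lambda_max M = last (eigenvals M)"


section \<open>Graphs\<close>

text \<open>A graph on the vertex set \<open>UNIV :: 'N set\<close> is given by its adjacency relation.\<close>

definition undirected :: "('N \<Rightarrow> 'N \<Rightarrow> bool) \<Rightarrow> bool" where
  "undirected E \<longleftrightarrow> symp E \<and> irreflp E"

definition connected_graph :: "('N \<Rightarrow> 'N \<Rightarrow> bool) \<Rightarrow> bool" where
  "connected_graph E \<longleftrightarrow> (\<forall>i j. E\<^sup>*\<^sup>* i j)"

definition union_graph :: "('s \<Rightarrow> 'N \<Rightarrow> 'N \<Rightarrow> bool) \<Rightarrow> 'N \<Rightarrow> 'N \<Rightarrow> bool" where
  "union_graph E i j \<longleftrightarrow> (\<exists>p. E p i j)"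

definition adj :: "('N \<Rightarrow> 'N \<Rightarrow> bool) \<Rightarrow> 'N \<Rightarrow> 'N \<Rightarrow> real" where
  "adj E i j = of_bool (E i j)"

definition laplacian :: "('N::finite \<Rightarrow> 'N \<Rightarrow> bool) \<Rightarrow> real^'N^'N" where
  "laplacian E = (\<chi> i j. if i = j then (\<Sum>k\<in>UNIV. adj E i k) else - adj E i j)"


section \<open>Continuous-time Markov processes with finite state space\<close>

definition rate_matrix :: "real^'s^'s \<Rightarrow> bool" where
  "rate_matrix \<Upsilon> \<longleftrightarrow> (\<forall>p q. p \<noteq> q \<longrightarrow> 0 \<le> \<Upsilon> $ p $ q) \<and> \<Upsilon> *v 1 = 0"

definition invariant_distribution :: "real^'s^'s \<Rightarrow> real^'s \<Rightarrow> bool" where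
  "invariant_distribution \<Upsilon> \<pi> \<longleftrightarrow> \<pi> v* \<Upsilon> = 0 \<and> (\<Sum>p\<in>UNIV. \<pi> $ p) = 1 \<and> (\<forall>p. 0 \<le> \<pi> $ p)"

text \<open>The transition matrix \<open>exp (h \<Upsilon>)\<close>.\<close>

definition trans_prob :: "real^'s^'s \<Rightarrow> real \<Rightarrow> real^'s^'s" where
  "trans_prob \<Upsilon> h = (\<Sum>k. (h ^ k / fact k) *\<^sub>R (((**) \<Upsilon> ^^ k) (mat 1)))"

text \<open>The transition probabilities converge to a strictly positive limit law that does not
  depend on the initial state; on a finite state space this amounts to irreducibility.\<close>

definition ergodic :: "real^'s^'s \<Rightarrow> bool" where
  "ergodic \<Upsilon> \<longleftrightarrow>
     (\<exists>\<mu>. \<forall>p q. 0 < \<mu> q \<and> ((\<lambda>h. trans_prob \<Upsilon> h $ p $ q) \<longlongrightarrow> \<mu> q) at_top)"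

definition markov_process ::
  "'w measure \<Rightarrow> (real \<Rightarrow> 'w \<Rightarrow> 's::finite) \<Rightarrow> real^'s^'s \<Rightarrow> bool" where
  "markov_process M \<sigma> \<Upsilon> \<longleftrightarrow>
     rate_matrix \<Upsilon> \<and>
     (\<forall>t\<ge>0. \<sigma> t \<in> measurable M (count_space UNIV)) \<and>
     (AE \<omega> in M. \<forall>t\<ge>0. \<forall>\<^sub>F r in at_right t. \<sigma> r \<omega> = \<sigma> t \<omega>) \<and>
     (\<forall>(k::nat) t q q' h.
        0 \<le> t 0 \<and> strict_mono_on {..k} t \<and> 0 \<le> h \<and>
        \<P>(\<omega> in M. \<forall>j\<le>k. \<sigma> (t j) \<omega> = q j) \<noteq> 0 \<longrightarrow>
        \<P>(\<omega> in M. \<sigma> (t k + h) \<omega> = q' \<bar> \<forall>j\<le>k. \<sigma> (t j) \<omega> = q j)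
          = trans_prob \<Upsilon> h $ q k $ q')"


section \<open>The closed-loop system along one sample path\<close>

text \<open>Right-hand sides are only piecewise continuous or measurable in time, so \<open>x' = f\<close> is
  understood in the sense of Caratheodory, on the time interval \<open>[0, T)\<close>, \<open>T \<le> \<infinity>\<close>.\<close>

definition ode_on :: "ereal \<Rightarrow> (real \<Rightarrow> 'v::euclidean_space) \<Rightarrow> (real \<Rightarrow> 'v) \<Rightarrow> bool" where
  "ode_on T x f \<longleftrightarrow> (\<forall>r\<ge>0. ereal r < T \<longrightarrow>
     f absolutely_integrable_on {0..r} \<and> x r = x 0 + integral {0..r} f)"

text \<open>The triggering instants of an agent are \<open>t 0 = 0, t 1, t 2, \<dots>\<close>; the value \<open>t k = \<infinity>\<close> means that
  there is no \<open>k\<close>-th event. The function \<open>latest t\<close> gives the latest instant up to and including a given time.\<close>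

definition latest :: "(nat \<Rightarrow> ereal) \<Rightarrow> real \<Rightarrow> real" where
  "latest t r = real_of_ereal (t (THE k. t k \<le> ereal r \<and> ereal r < t (Suc k)))"

definition zeno :: "(nat \<Rightarrow> ereal) \<Rightarrow> bool" where
  "zeno t \<longleftrightarrow> (\<exists>b::real. infinite {k. t k \<le> ereal b})"

text \<open>With all states sampled at the latest triggering instants, the sum
  \<open>\<Sum>j. a i j (\<sigma> r) (xh j (t\<^sub>k j) - xh i (t\<^sub>k i))\<close>.\<close>

definition rel_err :: "('s \<Rightarrow> 'N::finite \<Rightarrow> 'N \<Rightarrow> bool) \<Rightarrow> (real \<Rightarrow> 's) \<Rightarrow>
    ('N \<Rightarrow> real \<Rightarrow> real^'n) \<Rightarrow> ('N \<Rightarrow> nat \<Rightarrow> ereal) \<Rightarrow> 'N \<Rightarrow> real \<Rightarrow> real^'n" where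
  "rel_err E \<sigma> xh t i r =
     (\<Sum>j\<in>UNIV. adj (E (\<sigma> r)) i j *\<^sub>R (xh j (latest (t j) r) - xh i (latest (t i) r)))"

text \<open>The system is considered on an interval \<open>[0, T)\<close> on which every time has a latest triggering
  instant for each agent. Demanding this for all times would exclude Zeno behavior by fiat; with
  \<open>T\<close> arbitrary, the triggering instants may a priori accumulate at a finite \<open>T\<close>.

  Plant, observer and gains: \<open>A B C G K \<Gamma>\<close>; graphs: \<open>E\<close>; event-triggering parameters:
  \<open>th\<close> (the factor in \<open>(0,1)\<close>), \<open>\<upsilon> \<iota> \<eta> \<zeta>\<close>; adaptation: \<open>\<beta> dbar\<close>;
  initial values: \<open>x0 xh0 d0 w0\<close>; sample path: switching signal \<open>\<sigma>\<close>, attack indicators \<open>\<alpha>\<close>,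
  attacks \<open>\<epsilon>\<close>, states \<open>x\<close>, observer states \<open>xh\<close>, adaptive gains \<open>d\<close>,
  thresholds \<open>w\<close>, triggering instants \<open>t\<close>.\<close>

definition closed_loop ::
  "real^'n^'n \<Rightarrow> real^'m^'n \<Rightarrow> real^'n^'y \<Rightarrow> real^'y^'n \<Rightarrow> real^'n^'m \<Rightarrow> real^'n^'n \<Rightarrow>
   ('s \<Rightarrow> 'N::finite \<Rightarrow> 'N \<Rightarrow> bool) \<Rightarrow>
   ('N \<Rightarrow> real) \<Rightarrow> ('N \<Rightarrow> real) \<Rightarrow> ('N \<Rightarrow> real) \<Rightarrow> ('N \<Rightarrow> real) \<Rightarrow> ('N \<Rightarrow> real) \<Rightarrow>
   ('N \<Rightarrow> real) \<Rightarrow> ('N \<Rightarrow> real) \<Rightarrow>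
   ('N \<Rightarrow> real^'n) \<Rightarrow> ('N \<Rightarrow> real^'n) \<Rightarrow> ('N \<Rightarrow> real) \<Rightarrow> ('N \<Rightarrow> real) \<Rightarrow>
   ereal \<Rightarrow> (real \<Rightarrow> 's) \<Rightarrow> ('N \<Rightarrow> real \<Rightarrow> real) \<Rightarrow> (real \<Rightarrow> real^'y^'N) \<Rightarrow>
   ('N \<Rightarrow> real \<Rightarrow> real^'n) \<Rightarrow> ('N \<Rightarrow> real \<Rightarrow> real^'n) \<Rightarrow> ('N \<Rightarrow> real \<Rightarrow> real) \<Rightarrow>
   ('N \<Rightarrow> real \<Rightarrow> real) \<Rightarrow> ('N \<Rightarrow> nat \<Rightarrow> ereal) \<Rightarrow> bool" where
  "closed_loop A B C G K \<Gamma> E th \<upsilon> \<iota> \<eta> \<zeta> \<beta> dbar x0 xh0 d0 w0 T \<sigma> \<alpha> \<epsilon> x xh d w t \<longleftrightarrow>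
    (let \<xi> = rel_err E \<sigma> xh t;
         \<xi>t = (\<lambda>i r. \<xi> i (latest (t i) r));
         m = (\<lambda>i r. xh i (latest (t i) r) - xh i r);
         u = (\<lambda>i r. d i r *\<^sub>R (K *v \<xi> i r));
         yb = (\<lambda>i r. C *v x i r + \<alpha> i r *\<^sub>R (\<epsilon> r $ i))
     in 0 < T \<and> (\<forall>i.
        x i 0 = x0 i \<and> xh i 0 = xh0 i \<and> d i 0 = d0 i \<and> w i 0 = w0 i \<and>
        ode_on T (x i) (\<lambda>r. A *v x i r + B *v u i r) \<and>
        ode_on T (xh i) (\<lambda>r. A *v xh i r + B *v u i r + G *v (yb i r - C *v xh i r)) \<and>
        ode_on T (d i) (\<lambda>r. if d i r < dbar i then \<beta> i * quad \<Gamma> (\<xi>t i r) else 0) \<and>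
        ode_on T (w i) (\<lambda>r. - \<eta> i * w i r
          + \<zeta> i * (th i * \<upsilon> i * quad \<Gamma> (\<xi>t i r) - quad \<Gamma> (m i r))) \<and>
        t i 0 = 0 \<and>
        (\<forall>k. t i (Suc k) = Inf {ereal r | r. t i k < ereal r \<and> ereal r < T \<and>
           (let tk = real_of_ereal (t i k) in
             \<iota> i * (quad \<Gamma> (xh i tk - xh i r) - th i * \<upsilon> i * quad \<Gamma> (\<xi> i tk)) \<ge> w i r)}) \<and>
        (\<forall>r\<ge>0. ereal r < T \<longrightarrow> (\<exists>k. t i k \<le> ereal r \<and> ereal r < t i (Suc k)))))"

end

theory Submission
  imports Defs
begin

text \<open>The argument is pathwise, and no stability is needed. On a bounded time interval the running
  supremum of all plant and observer states obeys a Gronwall estimate whose constants depend neither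
  on the sample path nor on \<open>T\<close>, because the adaptive gains are capped by \<open>dbar\<close> and the attacks are
  bounded. Hence the observer states are Lipschitz, and \<open>m\<^sub>i\<close> grows at most linearly after an event.
  Between events the triggering condition is false, which turns the equation of \<open>w i\<close> into
  \<open>w' \<ge> - (\<eta> + \<zeta> / \<iota>) w\<close>; so the threshold stays above a decaying exponential, and an event can only
  occur after the square of the linear bound on \<open>m\<^sub>i\<close> has reached it.\<close>

section \<open>Integral calculus for Caratheodory solutions\<close>

lemma ode_on_integrable:
  assumes "ode_on T x f" "0 \<le> q" "q \<le> r" "ereal r < T"
  shows "f integrable_on {q..r}"
proof -
  have "f absolutely_integrable_on {0..r}"
    using assms unfolding ode_on_def by (meson order_trans)
  then have "f integrable_on {0..r}"
    by (rule set_lebesgue_integral_eq_integral)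
  then show ?thesis
    by (rule integrable_on_subinterval) (use assms in auto)
qed

lemma ode_on_diff:
  assumes "ode_on T x f" "0 \<le> q" "q \<le> r" "ereal r < T"
  shows "x r - x q = integral {q..r} f"
proof -
  have "ereal q < T"
    by (rule le_less_trans[OF _ assms(4)]) (use assms in simp)
  then have "x r = x 0 + integral {0..r} f" "x q = x 0 + integral {0..q} f"
    using assms by (auto simp only: ode_on_def dest: order_trans)
  moreover have "integral {0..q} f + integral {q..r} f = integral {0..r} f"
    using assms by (intro Henstock_Kurzweil_Integration.integral_combine ode_on_integrable) auto
  ultimately show ?thesis by (simp add: algebra_simps)
qed

lemma ode_on_continuous:
  assumes "ode_on T x f" "ereal r < T"
  shows "continuous_on {0..r} x"
proof (cases "0 \<le> r")
  case True
  have *: "continuous_on {0..r} (\<lambda>q. x 0 + integral {0..q} f)"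
    by (intro continuous_on_add continuous_on_const indefinite_integral_continuous_1
        ode_on_integrable[OF assms(1) order_refl True assms(2)])
  have eq: "x 0 + integral {0..q} f = x q" if "q \<in> {0..r}" for q
  proof -
    have "ereal q < T"
      by (rule le_less_trans[OF _ assms(2)]) (use that in simp)
    then have "x q - x 0 = integral {0..q} f"
      using that by (intro ode_on_diff[OF assms(1)]) auto
    then show ?thesis
      by (simp add: algebra_simps)
  qed
  show ?thesis
    by (rule continuous_on_eq[OF * eq])
qed auto

text \<open>Serves to supply the explicit comparison functions, exponentials and constants, as
  solutions on every \<open>[0, T)\<close>, through the fundamental theorem of calculus.\<close>

lemma ode_on_C1:
  fixes x :: "real \<Rightarrow> 'v::euclidean_space"
  assumes "\<And>r. (x has_vector_derivative f r) (at r)" "continuous_on UNIV f"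
  shows "ode_on T x f"
  unfolding ode_on_def
proof (intro allI impI conjI)
  fix r :: real assume "0 \<le> r"
  show "f absolutely_integrable_on {0..r}"
    using continuous_on_subset[OF assms(2)] by (intro absolutely_integrable_continuous_real) auto
  have "(f has_integral (x r - x 0)) {0..r}"
    by (rule fundamental_theorem_of_calculus[OF \<open>0 \<le> r\<close>])
       (rule has_vector_derivative_at_within[OF assms(1)])
  then show "x r = x 0 + integral {0..r} f"
    by (simp add: integral_unique)
qed

lemma ode_on_exp: "ode_on T (\<lambda>r. K * exp (a * r)) (\<lambda>r. a * (K * exp (a * r)))"
  for K a :: real
proof (rule ode_on_C1)
  show "((\<lambda>r. K * exp (a * r)) has_vector_derivative a * (K * exp (a * r))) (at r)" for r
    unfolding has_real_derivative_iff_has_vector_derivative[symmetric]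
    by (auto intro!: derivative_eq_intros)
qed (intro continuous_intros)

lemma ode_on_const: "ode_on T (\<lambda>_. a) (\<lambda>_. 0)"
  by (rule ode_on_C1) auto

section \<open>Comparison, growth and Lipschitz estimates\<close>

text \<open>After the last time \<open>s\<close> in \<open>{0..r}\<close> with
  \<open>z s \<le> y s\<close>, the function \<open>y\<close> stays strictly below \<open>z\<close>,
  so \<open>g \<le> f\<close> there, and integrating from \<open>s\<close> to \<open>r\<close>
  carries the inequality to \<open>r\<close>. Since the slopes are compared only where
  \<open>y q < z q\<close>, they may depend on the solutions themselves.\<close>

lemma ode_on_compare:
  fixes y z f g :: "real \<Rightarrow> real"
  assumes y: "ode_on T y f" and z: "ode_on T z g" and init: "z 0 \<le> y 0"
    and below: "\<And>q. \<lbrakk>0 \<le> q; ereal q < T; y q < z q\<rbrakk> \<Longrightarrow> g q \<le> f q"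
    and r: "0 \<le> r" "ereal r < T"
  shows "z r \<le> y r"
proof (rule ccontr)
  assume "\<not> z r \<le> y r"
  define S where "S = {q \<in> {0..r}. z q \<le> y q}"
  define s where "s = Sup S"
  have "continuous_on {0..r} y" "continuous_on {0..r} z"
    using y z r ode_on_continuous by blast+
  then have "closed S"
    unfolding S_def by (intro continuous_on_closed_Collect_le) auto
  moreover have "S \<noteq> {}" "bdd_above S"
    using init r by (auto simp: S_def intro!: bdd_aboveI[of _ r])
  ultimately have "s \<in> S" and upper: "\<And>q. q \<in> S \<Longrightarrow> q \<le> s"
    unfolding s_def by (blast intro: closed_contains_Sup cSup_upper)+
  then have s: "0 \<le> s" "s \<le> r" "z s \<le> y s"
    by (auto simp: S_def)
  have "g q \<le> f q" if "q \<in> {s..r} - {s}" for q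
  proof (rule below)
    have "q \<notin> S" using upper[of q] that by auto
    then show "y q < z q" using that s by (auto simp: S_def)
    show "ereal q < T" by (rule le_less_trans[OF _ r(2)]) (use that in simp)
  qed (use that s in auto)
  \<comment> \<open>At \<open>s\<close> itself \<open>below\<close> says nothing. Replacing
    \<open>g\<close> by \<open>f\<close> at this single point leaves the integral unchanged and
    gives an inequality on all of \<open>{s..r}\<close>.\<close>
  moreover have "(\<lambda>q. if q = s then f q else g q) integrable_on {s..r}"
    by (rule integrable_spike[OF ode_on_integrable[OF z s(1,2) r(2)], of "{s}"]) auto
  ultimately have "integral {s..r} (\<lambda>q. if q = s then f q else g q) \<le> integral {s..r} f"
    using ode_on_integrable[OF y s(1,2) r(2)] by (intro integral_le) auto
  moreover have "integral {s..r} (\<lambda>q. if q = s then f q else g q) = integral {s..r} g"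
    by (rule integral_spike[of "{s}"]) auto
  ultimately show False
    using ode_on_diff[OF y s(1,2) r(2)] ode_on_diff[OF z s(1,2) r(2)] s(3) \<open>\<not> z r \<le> y r\<close>
    by linarith
qed

text \<open>The right-hand sides depend on sampled, hence delayed, states, so the usual Gronwall lemma for the
  current state does not apply.\<close>

lemma ode_on_running_sup_growth:
  fixes x f :: "'i::finite \<Rightarrow> real \<Rightarrow> 'v::euclidean_space"
  assumes ode: "\<And>i. ode_on T (x i) (f i)"
    and init: "\<And>i. norm (x i 0) < R"
    and growth: "\<And>i r S. \<lbrakk>0 \<le> r; ereal r < T; R \<le> S; \<And>j q. \<lbrakk>0 \<le> q; q \<le> r\<rbrakk> \<Longrightarrow> norm (x j q) \<le> S\<rbrakk>
      \<Longrightarrow> norm (f i r) \<le> a * S"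
    and "0 \<le> a" and r: "0 \<le> r" "ereal r < T"
  shows "norm (x i r) \<le> R * exp (a * r)"
proof -
  have "0 < R" using init norm_ge_zero le_less_trans by blast
  define \<phi> where "\<phi> = (\<lambda>q. R * exp (a * q))"
  have \<phi>_mono: "\<phi> p \<le> \<phi> q" if "p \<le> q" for p q
    using that \<open>0 < R\<close> \<open>0 \<le> a\<close> by (simp add: \<phi>_def mult_left_mono)
  have \<phi>: "ode_on T \<phi> (\<lambda>q. a * \<phi> q)"
    unfolding \<phi>_def by (rule ode_on_exp)
  \<comment> \<open>The times at which some component has reached \<open>\<phi>\<close>. As a finite
    union of closed sets it contains its infimum, the first such time.\<close>
  define S where "S = (\<Union>j. {q \<in> {0..r}. \<phi> q \<le> norm (x j q)})"
  have "S = {}"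
  proof (rule ccontr)
    assume "S \<noteq> {}"
    have "closed S"
      unfolding S_def
    proof (intro closed_UN finite_class.finite_UNIV ballI continuous_on_closed_Collect_le)
      show "continuous_on {0..r} \<phi>" "continuous_on {0..r} (\<lambda>q. norm (x j q))" for j
        using ode_on_continuous[OF \<phi> r(2)] ode_on_continuous[OF ode r(2), of j]
        by (auto intro: continuous_on_norm)
    qed auto
    moreover have "bdd_below S"
      by (auto simp: S_def intro!: bdd_belowI[of _ 0])
    ultimately have "Inf S \<in> S" and lower: "\<And>q. q \<in> S \<Longrightarrow> Inf S \<le> q"
      using \<open>S \<noteq> {}\<close> by (blast intro: closed_contains_Inf cInf_lower)+
    define s where "s = Inf S"
    from \<open>Inf S \<in> S\<close> obtain j where s: "0 \<le> s" "s \<le> r" "\<phi> s \<le> norm (x j s)"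
      by (auto simp: S_def s_def)
    have sT: "ereal s < T"
      by (rule le_less_trans[OF _ r(2)]) (use s in simp)
    have before: "norm (x i q) \<le> \<phi> q" if "0 \<le> q" "q < s" for i q
    proof (rule ccontr)
      assume "\<not> norm (x i q) \<le> \<phi> q"
      then have "q \<in> S" using that s by (auto simp: S_def intro!: exI[of _ i])
      then show False using lower[of q] that by (simp add: s_def)
    qed
    \<comment> \<open>Before \<open>s\<close> all components lie below \<open>\<phi>\<close>, and
      \<open>\<phi>\<close> is increasing, so \<open>\<phi> q\<close> bounds the whole history up to
      \<open>q\<close>; this is the premise of \<open>growth\<close>.\<close>
    have bound: "norm (f j q) \<le> a * \<phi> q" if "q \<in> {0..s} - {s}" for q
    proof (rule growth)
      show "R \<le> \<phi> q" using \<phi>_mono[of 0 q] that by (simp add: \<phi>_def)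
      show "ereal q < T" by (rule le_less_trans[OF _ sT]) (use that in simp)
      show "norm (x i p) \<le> \<phi> q" if "0 \<le> p" "p \<le> q" for i p
        using before[of p i] \<phi>_mono[of p q] that \<open>q \<in> {0..s} - {s}\<close> by auto
    qed (use that in auto)
    have "(\<lambda>q. if q = s then 0 else f j q) integrable_on {0..s}"
      by (rule integrable_spike[OF ode_on_integrable[OF ode[of j] order_refl s(1) sT], of "{s}"]) auto
    then have "norm (integral {0..s} (\<lambda>q. if q = s then 0 else f j q)) \<le> integral {0..s} (\<lambda>q. a * \<phi> q)"
      using ode_on_integrable[OF \<phi> order_refl s(1) sT] bound \<open>0 \<le> a\<close> \<open>0 < R\<close>
      by (intro integral_norm_bound_integral) (auto simp: \<phi>_def)
    also have "integral {0..s} (\<lambda>q. if q = s then 0 else f j q) = integral {0..s} (f j)"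
      by (rule integral_spike[of "{s}"]) auto
    \<comment> \<open>Component \<open>j\<close> moves no farther than \<open>\<phi>\<close> does,
      but it starts strictly below \<open>\<phi> 0 = R\<close>; hence it cannot have reached
      \<open>\<phi>\<close> at \<open>s\<close>.\<close>
    finally have "norm (x j s - x j 0) \<le> \<phi> s - \<phi> 0"
      using ode_on_diff[OF ode order_refl s(1) sT] ode_on_diff[OF \<phi> order_refl s(1) sT] by simp
    moreover have "norm (x j s) \<le> norm (x j 0) + norm (x j s - x j 0)"
      using norm_triangle_sub by blast
    ultimately show False
      using s(3) init[of j] by (simp add: \<phi>_def)
  qed
  then have "r \<notin> {q \<in> {0..r}. \<phi> q \<le> norm (x i q)}"
    unfolding S_def by blast
  then show ?thesis
    using r by (simp add: \<phi>_def)
qed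

lemma ode_on_lipschitz:
  assumes x: "ode_on T x f" and q: "0 \<le> q" "q \<le> r" "ereal r < T"
    and bound: "\<And>p. \<lbrakk>q \<le> p; p \<le> r\<rbrakk> \<Longrightarrow> norm (f p) \<le> V"
  shows "norm (x r - x q) \<le> V * (r - q)"
proof -
  have "norm (integral {q..r} f) \<le> integral {q..r} (\<lambda>_. V)"
    using ode_on_integrable[OF x q] bound by (intro integral_norm_bound_integral) auto
  then show ?thesis
    using ode_on_diff[OF x q] q by (simp add: mult.commute)
qed

section \<open>Estimates along one sample path\<close>

text \<open>The bounding constants are parameters, so that the same values can serve all sample
  paths. Here \<open>kB\<close> and \<open>kC\<close> bound the products of \<open>B\<close> with
  \<open>K\<close> and of \<open>G\<close> with \<open>C\<close>, \<open>D\<close> caps the adaptive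
  gains and \<open>e\<close> bounds the attacks.\<close>

locale attacked_loop =
  fixes A :: "real^'n^'n" and B :: "real^'m^'n" and C :: "real^'n^'y" and G :: "real^'y^'n"
    and K :: "real^'n^'m" and \<Gamma> :: "real^'n^'n"
    and E :: "'s \<Rightarrow> 'N::finite \<Rightarrow> 'N \<Rightarrow> bool"
    and th \<upsilon> \<iota> \<eta> \<zeta> \<beta> dbar :: "'N \<Rightarrow> real" and x0 xh0 :: "'N \<Rightarrow> real^'n" and d0 w0 :: "'N \<Rightarrow> real"
    and T :: ereal and \<sigma> :: "real \<Rightarrow> 's" and \<alpha> :: "'N \<Rightarrow> real \<Rightarrow> real" and \<epsilon> :: "real \<Rightarrow> real^'y^'N"
    and x xh :: "'N \<Rightarrow> real \<Rightarrow> real^'n" and d w :: "'N \<Rightarrow> real \<Rightarrow> real" and t :: "'N \<Rightarrow> nat \<Rightarrow> ereal"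
    and kA kB kC kG k\<Gamma> D e :: real
  assumes loop: "closed_loop A B C G K \<Gamma> E th \<upsilon> \<iota> \<eta> \<zeta> \<beta> dbar x0 xh0 d0 w0 T \<sigma> \<alpha> \<epsilon> x xh d w t"
    and \<Gamma>_nonneg: "\<And>v. 0 \<le> quad \<Gamma> v"
    and \<Gamma>_le: "\<And>v. quad \<Gamma> v \<le> k\<Gamma> * (norm v)\<^sup>2"
    and attack: "\<And>i r. 0 \<le> r \<Longrightarrow> \<alpha> i r \<in> {0, 1}" "\<And>r. 0 \<le> r \<Longrightarrow> norm (\<epsilon> r) \<le> e"
    and kA: "\<And>v. norm (A *v v) \<le> kA * norm v"
    and kB: "\<And>v. norm (B *v (K *v v)) \<le> kB * norm v"
    and kC: "\<And>v. norm (G *v (C *v v)) \<le> kC * norm v"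
    and kG: "\<And>v. norm (G *v v) \<le> kG * norm v"
    and consts_nonneg: "0 \<le> kA" "0 \<le> kB" "0 \<le> kC" "0 \<le> kG" "0 \<le> k\<Gamma>"
    and gains: "\<And>i. 0 \<le> d0 i" "\<And>i. d0 i \<le> dbar i" "\<And>i. dbar i \<le> D" "\<And>i. 0 \<le> \<beta> i"
    and w0_pos: "\<And>i. 0 < w0 i"
    and trig: "\<And>i. 0 \<le> th i * \<upsilon> i" "\<And>i. 0 < \<iota> i" "\<And>i. 0 \<le> \<eta> i" "\<And>i. 0 \<le> \<zeta> i"
begin

abbreviation "\<xi> \<equiv> rel_err E \<sigma> xh t"

abbreviation "fx i r \<equiv> A *v x i r + B *v (d i r *\<^sub>R (K *v \<xi> i r))"

abbreviation "fxh i r \<equiv> A *v xh i r + B *v (d i r *\<^sub>R (K *v \<xi> i r))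
  + G *v (C *v x i r + \<alpha> i r *\<^sub>R (\<epsilon> r $ i) - C *v xh i r)"

lemma init: "x i 0 = x0 i" "xh i 0 = xh0 i" "d i 0 = d0 i" "w i 0 = w0 i" "t i 0 = 0"
  using loop unfolding closed_loop_def Let_def by blast+

lemma ode_x: "ode_on T (x i) (fx i)"
  and ode_xh: "ode_on T (xh i) (fxh i)"
  and ode_d: "ode_on T (d i) (\<lambda>r. if d i r < dbar i then \<beta> i * quad \<Gamma> (\<xi> i (latest (t i) r)) else 0)"
  and ode_w: "ode_on T (w i) (\<lambda>r. - \<eta> i * w i r + \<zeta> i * (th i * \<upsilon> i * quad \<Gamma> (\<xi> i (latest (t i) r))
    - quad \<Gamma> (xh i (latest (t i) r) - xh i r)))"
  using loop unfolding closed_loop_def Let_def by blast+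

lemma t_Suc: "t i (Suc k) = Inf {ereal r | r. t i k < ereal r \<and> ereal r < T \<and>
    w i r \<le> \<iota> i * (quad \<Gamma> (xh i (real_of_ereal (t i k)) - xh i r)
      - th i * \<upsilon> i * quad \<Gamma> (\<xi> i (real_of_ereal (t i k))))}"
  using loop unfolding closed_loop_def Let_def by blast

lemma t_mono: "k \<le> l \<Longrightarrow> t i k \<le> t i l"
proof (rule lift_Suc_mono_le)
  show "t i n \<le> t i (Suc n)" for n
    unfolding t_Suc[of i n] by (rule Inf_greatest) auto
qed

lemma t_nonneg: "0 \<le> t i k"
  using t_mono[of 0 k i] by (simp add: init)

text \<open>Monotone instants make the index \<open>k\<close> unique, so the \<open>THE\<close> in
  \<open>latest\<close> denotes it. The instant lies between 0 and \<open>r\<close>, hence is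
  finite, and its conversion to a real number loses nothing.\<close>

lemma latest_cases:
  assumes "0 \<le> r" "ereal r < T"
  obtains k where "t i k = ereal (latest (t i) r)" "t i k \<le> ereal r" "ereal r < t i (Suc k)"
proof -
  obtain k where k: "t i k \<le> ereal r" "ereal r < t i (Suc k)"
    using loop assms unfolding closed_loop_def Let_def by blast
  have "(THE k. t i k \<le> ereal r \<and> ereal r < t i (Suc k)) = k"
  proof (rule the_equality)
    fix l assume l: "t i l \<le> ereal r \<and> ereal r < t i (Suc l)"
    have "\<not> k < l" "\<not> l < k"
      using k l t_mono[of "Suc k" l i] t_mono[of "Suc l" k i] by (auto simp: Suc_le_eq)
    then show "l = k" by simp
  qed (use k in simp)
  then have "latest (t i) r = real_of_ereal (t i k)"
    by (simp add: latest_def)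
  moreover have "ereal (real_of_ereal (t i k)) = t i k"
    using k(1) t_nonneg[of i k] by (cases "t i k") auto
  ultimately show ?thesis
    using k that by simp
qed

lemma latest_range:
  assumes "0 \<le> r" "ereal r < T"
  shows "0 \<le> latest (t i) r" "latest (t i) r \<le> r"
proof -
  obtain k where "t i k = ereal (latest (t i) r)" "t i k \<le> ereal r"
    using latest_cases[OF assms] by blast
  then show "0 \<le> latest (t i) r" "latest (t i) r \<le> r"
    using t_nonneg[of i k] by auto
qed

text \<open>A time strictly after the latest event at which the condition held would belong to the
  set whose infimum is the next instant, which would then come no later than
  \<open>r\<close>.\<close>

lemma untriggered:
  assumes "0 \<le> r" "ereal r < T" "latest (t i) r \<noteq> r"
  shows "\<iota> i * (quad \<Gamma> (xh i (latest (t i) r) - xh i r)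
    - th i * \<upsilon> i * quad \<Gamma> (\<xi> i (latest (t i) r))) < w i r"
proof (rule ccontr)
  assume contra: "\<not> ?thesis"
  obtain k where k: "t i k = ereal (latest (t i) r)" "t i k \<le> ereal r" "ereal r < t i (Suc k)"
    using latest_cases[OF assms(1,2)] by blast
  have "t i k < ereal r"
    using k assms by auto
  then have "t i (Suc k) \<le> ereal r"
    unfolding t_Suc using contra assms k(1) by (intro Inf_lower) (auto simp: not_less)
  with k(3) show False by simp
qed

section \<open>Adaptive gains and thresholds\<close>

text \<open>Two comparisons with constants: the slope of \<open>d i\<close> is nonnegative, and it
  vanishes wherever \<open>d i\<close> exceeds \<open>dbar i\<close>.\<close>

lemma d_range:
  assumes "0 \<le> r" "ereal r < T"
  shows "0 \<le> d i r" "d i r \<le> D"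
proof -
  have "d0 i \<le> d i r"
    by (rule ode_on_compare[OF ode_d ode_on_const _ _ assms])
       (use init gains \<Gamma>_nonneg in auto)
  then show "0 \<le> d i r"
    using gains(1)[of i] by simp
  have "d i r \<le> dbar i"
    by (rule ode_on_compare[OF ode_on_const ode_d _ _ assms])
       (use init gains in auto)
  then show "d i r \<le> D"
    using gains(3)[of i] by simp
qed

text \<open>The exponential solves \<open>z' = - (\<eta> i + \<zeta> i / \<iota> i) * z\<close> with
  the same initial value. The slopes have to be compared only while \<open>w i\<close> is below it,
  and there the larger value \<open>z\<close> may replace \<open>w i\<close> in the decay term.
  Positivity of the threshold is thus a consequence.\<close>

lemma threshold_ge:
  assumes "0 \<le> r" "ereal r < T"
  shows "w0 i * exp (- (\<eta> i + \<zeta> i / \<iota> i) * r) \<le> w i r"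
proof (rule ode_on_compare[OF ode_w ode_on_exp _ _ assms])
  fix q assume q: "0 \<le> q" "ereal q < T"
    and below: "w i q < w0 i * exp (- (\<eta> i + \<zeta> i / \<iota> i) * q)" (is "_ < ?z")
  define Y where "Y = th i * \<upsilon> i * quad \<Gamma> (\<xi> i (latest (t i) q)) - quad \<Gamma> (xh i (latest (t i) q) - xh i q)"
  have "0 < ?z" by (rule mult_pos_pos) (simp_all add: w0_pos)
  have "0 \<le> \<zeta> i / \<iota> i" using trig[of i] by simp
  have "- (\<eta> i + \<zeta> i / \<iota> i) * ?z \<le> - \<eta> i * w i q + \<zeta> i * Y"
  proof (cases "latest (t i) q = q")
    \<comment> \<open>At an event instant the sampling error is zero, so only the nonnegative term
      of \<open>Y\<close> remains.\<close>
    case True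
    then have "0 \<le> Y"
      using \<Gamma>_nonneg trig(1)[of i] by (simp add: Y_def) (simp add: quad_def)
    then have "0 \<le> \<zeta> i * Y" using trig(4)[of i] by simp
    moreover have "\<eta> i * w i q \<le> \<eta> i * ?z"
      using below trig(3)[of i] by (intro mult_left_mono) auto
    moreover have "0 \<le> \<zeta> i / \<iota> i * ?z"
      using \<open>0 < ?z\<close> \<open>0 \<le> \<zeta> i / \<iota> i\<close> by (simp only: mult_nonneg_nonneg less_imp_le)
    ultimately show ?thesis
      by (simp only: distrib_right mult_minus_left minus_add_distrib)
  next
    \<comment> \<open>Dividing the violated triggering condition by \<open>\<iota> i\<close> bounds
      \<open>Y\<close> below by \<open>- (w i q / \<iota> i)\<close>; this is the origin of the
      extra decay rate \<open>\<zeta> i / \<iota> i\<close>.\<close>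
    case False
    then have "- Y * \<iota> i < w i q"
      using untriggered[OF q False] by (simp add: Y_def algebra_simps)
    then have "- (w i q / \<iota> i) \<le> Y"
      using trig(2)[of i] by (simp add: field_simps)
    then have "\<zeta> i * - (w i q / \<iota> i) \<le> \<zeta> i * Y"
      using trig(4)[of i] by (intro mult_left_mono) auto
    moreover have "(\<eta> i + \<zeta> i / \<iota> i) * w i q \<le> (\<eta> i + \<zeta> i / \<iota> i) * ?z"
      using below trig(3)[of i] \<open>0 \<le> \<zeta> i / \<iota> i\<close> by (intro mult_left_mono) auto
    ultimately show ?thesis
      by (simp add: algebra_simps)
  qed
  then show "- (\<eta> i + \<zeta> i / \<iota> i) * ?z \<le> - \<eta> i * w i q
    + \<zeta> i * (th i * \<upsilon> i * quad \<Gamma> (\<xi> i (latest (t i) q)) - quad \<Gamma> (xh i (latest (t i) q) - xh i q))"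
    by (simp add: Y_def)
qed (simp add: init)

section \<open>Growth of the plant and observer states\<close>

text \<open>A rate for the running supremum of all states. The factor
  \<open>2 * real CARD('N)\<close> counts two sampled states for each possible neighbour, and
  \<open>2 * kC\<close> accounts for \<open>x\<close> and \<open>xh\<close> in the output
  error.\<close>

definition growth :: real where
  "growth = kA + D * (kB * (2 * real CARD('N))) + 2 * kC + kG * e"

lemma D_nonneg: "0 \<le> D"
  using gains(1-3)[of undefined] by linarith

lemma e_nonneg: "0 \<le> e"
  using attack(2)[of 0] norm_ge_zero[of "\<epsilon> 0"] by linarith

lemma growth_nonneg: "0 \<le> growth"
  using consts_nonneg D_nonneg e_nonneg by (simp add: growth_def)

text \<open>The sampled states in \<open>\<xi>\<close> belong to times in \<open>{0..r}\<close>, so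
  a bound on the whole past, not just on the present state, controls the right-hand sides.\<close>

lemma rhs_le:
  assumes r: "0 \<le> r" "ereal r < T" and S: "1 \<le> S"
    and bounded: "\<And>j q. \<lbrakk>0 \<le> q; q \<le> r\<rbrakk> \<Longrightarrow> norm (x j q) \<le> S"
      "\<And>j q. \<lbrakk>0 \<le> q; q \<le> r\<rbrakk> \<Longrightarrow> norm (xh j q) \<le> S"
  shows "norm (fx i r) \<le> growth * S" "norm (fxh i r) \<le> growth * S"
proof -
  have "norm (\<xi> i r) \<le> (\<Sum>j\<in>(UNIV :: 'N set). 2 * S)"
    unfolding rel_err_def
  proof (rule sum_norm_le)
    fix j
    have "norm (xh j (latest (t j) r) - xh i (latest (t i) r)) \<le> S + S"
      using latest_range[OF r] bounded(2) by (intro order_trans[OF norm_triangle_ineq4] add_mono) auto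
    then show "norm (adj (E (\<sigma> r)) i j *\<^sub>R (xh j (latest (t j) r) - xh i (latest (t i) r))) \<le> 2 * S"
      using S by (auto simp: adj_def of_bool_def)
  qed
  then have \<xi>: "norm (\<xi> i r) \<le> 2 * real CARD('N) * S"
    by simp
  have "norm (B *v (d i r *\<^sub>R (K *v \<xi> i r))) = d i r * norm (B *v (K *v \<xi> i r))"
    using d_range[OF r] by (simp add: matrix_vector_mult_scaleR)
  also have "\<dots> \<le> D * (kB * (2 * real CARD('N) * S))"
    using d_range[OF r] D_nonneg \<xi> consts_nonneg
    by (intro mult_mono order_trans[OF kB] mult_left_mono) auto
  finally have u: "norm (B *v (d i r *\<^sub>R (K *v \<xi> i r))) \<le> D * (kB * (2 * real CARD('N))) * S"
    by (simp add: mult.assoc)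
  have Ax: "norm (A *v v) \<le> kA * S" and GCx: "norm (G *v (C *v v)) \<le> kC * S" if "norm v \<le> S" for v
    using that consts_nonneg by (auto intro: order_trans[OF kA] order_trans[OF kC] mult_left_mono)
  have "norm (\<alpha> i r *\<^sub>R (\<epsilon> r $ i)) \<le> e"
    using attack(1)[OF r(1), of i] attack(2)[OF r(1)] e_nonneg Finite_Cartesian_Product.norm_nth_le[of "\<epsilon> r" i] by auto
  then have "norm (G *v (\<alpha> i r *\<^sub>R (\<epsilon> r $ i))) \<le> kG * e"
    using consts_nonneg by (intro order_trans[OF kG] mult_left_mono)
  \<comment> \<open>The attack contributes a constant, which \<open>1 \<le> S\<close> turns into a
    term linear in \<open>S\<close>.\<close>
  also have "\<dots> \<le> kG * e * S"
    using mult_left_mono[OF S, of "kG * e"] consts_nonneg e_nonneg by simp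
  finally have G\<epsilon>: "norm (G *v (\<alpha> i r *\<^sub>R (\<epsilon> r $ i))) \<le> kG * e * S" .
  have "norm (fx i r) \<le> kA * S + D * (kB * (2 * real CARD('N))) * S"
    using bounded(1) r by (intro order_trans[OF norm_triangle_ineq] add_mono Ax u) auto
  also have "\<dots> \<le> growth * S"
    using consts_nonneg e_nonneg S by (simp add: growth_def algebra_simps)
  finally show "norm (fx i r) \<le> growth * S" .
  have "fxh i r = A *v xh i r + B *v (d i r *\<^sub>R (K *v \<xi> i r)) + (G *v (C *v x i r)
      + G *v (\<alpha> i r *\<^sub>R (\<epsilon> r $ i)) - G *v (C *v xh i r))"
    by (simp add: matrix_vector_mult_diff_distrib matrix_vector_right_distrib)
  also have "norm \<dots> \<le> kA * S + D * (kB * (2 * real CARD('N))) * S + (kC * S + kG * e * S + kC * S)"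
    using bounded r
    by (intro order_trans[OF norm_triangle_ineq] order_trans[OF norm_triangle_ineq4] add_mono Ax GCx u G\<epsilon>) auto
  also have "\<dots> = growth * S"
    by (simp add: growth_def algebra_simps)
  finally show "norm (fxh i r) \<le> growth * S" .
qed

text \<open>Plant and observer states form a single family indexed by \<open>'N + 'N\<close>: each
  observer is driven by its plant and by sampled observers, so the estimates close only
  jointly.\<close>

lemma state_le:
  assumes R: "1 \<le> R" "\<And>i. norm (x0 i) < R" "\<And>i. norm (xh0 i) < R"
    and r: "0 \<le> r" "ereal r < T"
  shows "norm (x i r) \<le> R * exp (growth * r)" "norm (xh i r) \<le> R * exp (growth * r)"
proof -
  have *: "norm (case_sum x xh k r) \<le> R * exp (growth * r)" for k
  proof (rule ode_on_running_sup_growth[where f = "case_sum fx fxh", OF _ _ _ growth_nonneg r])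
    show "ode_on T (case_sum x xh k) (case_sum fx fxh k)" for k
      by (cases k) (simp_all add: ode_x ode_xh)
    show "norm (case_sum x xh k 0) < R" for k
      using R by (cases k) (simp_all add: init)
  next
    fix k q S assume q: "0 \<le> q" "ereal q < T" and "R \<le> S"
      and le: "\<And>j p. \<lbrakk>0 \<le> p; p \<le> q\<rbrakk> \<Longrightarrow> norm (case_sum x xh j p) \<le> S"
    show "norm (case_sum fx fxh k q) \<le> growth * S"
      using rhs_le[OF q, of S] le[of _ "Inl _"] le[of _ "Inr _"] R(1) \<open>R \<le> S\<close>
      by (cases k) simp_all
  qed
  show "norm (x i r) \<le> R * exp (growth * r)" "norm (xh i r) \<le> R * exp (growth * r)"
    using *[of "Inl i"] *[of "Inr i"] by simp_all
qed

section \<open>Minimum time between events\<close>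

text \<open>An event less than \<open>\<delta>\<close> after \<open>t i k\<close> would need a
  threshold no larger than a multiple of \<open>\<delta>\<^sup>2\<close>, below its exponential
  lower bound. All bounds are taken at \<open>b + 1\<close>, because \<open>\<delta> \<le> 1\<close>
  places such an event before that time.\<close>

lemma inter_event_time:
  assumes R: "1 \<le> R" "\<And>i. norm (x0 i) < R" "\<And>i. norm (xh0 i) < R"
    and \<delta>: "0 < \<delta>" "\<delta> \<le> 1"
      "\<iota> i * (k\<Gamma> * (growth * (R * exp (growth * (b + 1))) * \<delta>)\<^sup>2) < w0 i * exp (- (\<eta> i + \<zeta> i / \<iota> i) * (b + 1))"
    and k: "t i k \<le> ereal b"
  shows "t i k + ereal \<delta> \<le> t i (Suc k)"
  unfolding t_Suc
proof (rule Inf_greatest, clarify)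
  define V where "V = growth * (R * exp (growth * (b + 1)))"
  obtain q where q: "t i k = ereal q" "0 \<le> q" "q \<le> b"
    using k t_nonneg[of i k] by (cases "t i k") auto
  fix r assume r: "t i k < ereal r" "ereal r < T"
    and fire: "w i r \<le> \<iota> i * (quad \<Gamma> (xh i (real_of_ereal (t i k)) - xh i r)
      - th i * \<upsilon> i * quad \<Gamma> (\<xi> i (real_of_ereal (t i k))))"
  show "t i k + ereal \<delta> \<le> ereal r"
  proof (rule ccontr)
    assume "\<not> ?thesis"
    then have qr: "0 \<le> r" "q \<le> r" "r - q \<le> \<delta>" "r \<le> b + 1"
      using q r(1) \<delta>(2) by auto
    have V: "norm (fxh i p) \<le> V" if "q \<le> p" "p \<le> r" for p
      unfolding V_def
    proof (rule rhs_le(2))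
      show "0 \<le> p" using that q by simp
      show "ereal p < T"
        by (rule le_less_trans[OF _ r(2)]) (use that in simp)
      have "0 \<le> growth * (b + 1)" using growth_nonneg q by simp
      then show "1 \<le> R * exp (growth * (b + 1))"
        using mult_mono[of 1 R 1 "exp (growth * (b + 1))"] R(1) by simp
      fix j s assume s: "0 \<le> s" "s \<le> p"
      have "ereal s < T"
        by (rule le_less_trans[OF _ r(2)]) (use that s in simp)
      note s' = state_le[OF R s(1) this, of j]
      have "R * exp (growth * s) \<le> R * exp (growth * (b + 1))"
        using R(1) growth_nonneg s that qr by (intro mult_left_mono) (auto intro!: mult_left_mono)
      with s' show "norm (x j s) \<le> R * exp (growth * (b + 1))"
        "norm (xh j s) \<le> R * exp (growth * (b + 1))" by linarith+
    qed
    have "0 \<le> V"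
      using R(1) growth_nonneg by (simp add: V_def)
    have "norm (xh i q - xh i r) \<le> V * (r - q)"
      using ode_on_lipschitz[OF ode_xh q(2) qr(2) r(2) V] by (simp add: norm_minus_commute)
    also have "\<dots> \<le> V * \<delta>"
      using qr \<open>0 \<le> V\<close> by (intro mult_left_mono)
    finally have "(norm (xh i q - xh i r))\<^sup>2 \<le> (V * \<delta>)\<^sup>2"
      by (rule power_mono) simp
    then have "quad \<Gamma> (xh i q - xh i r) \<le> k\<Gamma> * (V * \<delta>)\<^sup>2"
      using consts_nonneg by (intro order_trans[OF \<Gamma>_le] mult_left_mono)
    \<comment> \<open>The relative error enters the triggering condition with a minus sign, so
      dropping it only enlarges the upper bound on \<open>w i r\<close>.\<close>
    moreover have "0 \<le> th i * \<upsilon> i * quad \<Gamma> (\<xi> i q)"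
      using \<Gamma>_nonneg trig(1) by simp
    ultimately have "w i r \<le> \<iota> i * (k\<Gamma> * (V * \<delta>)\<^sup>2)"
      using trig(2)[of i] by (intro order_trans[OF fire] mult_left_mono) (auto simp: q)
    also have "\<dots> < w0 i * exp (- (\<eta> i + \<zeta> i / \<iota> i) * (b + 1))"
      using \<delta>(3) by (simp add: V_def)
    also have "\<dots> \<le> w0 i * exp (- (\<eta> i + \<zeta> i / \<iota> i) * r)"
    proof -
      have "(\<eta> i + \<zeta> i / \<iota> i) * r \<le> (\<eta> i + \<zeta> i / \<iota> i) * (b + 1)"
        using trig[of i] qr by (intro mult_left_mono) auto
      then show ?thesis
        using w0_pos[of i] by (intro mult_left_mono) (auto simp only: exp_le_cancel_iff mult_minus_left neg_le_iff_le less_imp_le)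
    qed
    also have "\<dots> \<le> w i r"
      using threshold_ge[OF qr(1) r(2)] .
    finally show False by simp
  qed
qed

end

section \<open>Absence of accumulation and choice of constants\<close>

text \<open>By monotonicity, infinitely many instants below one bound put all of them below some
  natural \<open>n\<close>. The gap \<open>\<delta>\<close> belonging to \<open>n\<close> then
  forces \<open>t k\<close> to be at least \<open>k * \<delta>\<close>, which is unbounded.\<close>

lemma not_zeno_if_separated:
  assumes t: "incseq t" "t 0 = 0"
    and sep: "\<And>n::nat. \<exists>\<delta>>0. \<forall>k. t k \<le> ereal n \<longrightarrow> t k + ereal \<delta> \<le> t (Suc k)"
  shows "\<not> zeno t"
proof
  assume "zeno t"
  then obtain b where inf: "infinite {k. t k \<le> ereal b}"
    by (auto simp: zeno_def)
  obtain n :: nat where "b \<le> real n"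
    using real_arch_simple by blast
  have le: "t k \<le> ereal n" for k
  proof -
    obtain l where "k \<le> l" "t l \<le> ereal b"
      using inf by (auto simp: infinite_nat_iff_unbounded_le)
    then have "t k \<le> ereal b"
      using incseqD[OF t(1)] order_trans by blast
    also have "\<dots> \<le> ereal n"
      using \<open>b \<le> real n\<close> by simp
    finally show ?thesis .
  qed
  obtain \<delta> where \<delta>: "0 < \<delta>" "\<And>k. t k + ereal \<delta> \<le> t (Suc k)"
    using sep[of n] le by blast
  have "ereal (real k * \<delta>) \<le> t k" for k
  proof (induction k)
    case (Suc k)
    then have "ereal (real k * \<delta>) + ereal \<delta> \<le> t k + ereal \<delta>"
      by (rule add_right_mono)
    then show ?case
      using \<delta>(2)[of k] by (simp add: algebra_simps)
  qed (simp add: t zero_ereal_def)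
  moreover obtain k :: nat where "real n < real k * \<delta>"
    using reals_Archimedean3[OF \<delta>(1)] by blast
  ultimately have "ereal (real k * \<delta>) \<le> ereal n" "real n < real k * \<delta>"
    using le[of k] order_trans by blast+
  then show False by simp
qed

lemma mat_vec_bound:
  fixes L :: "real^'a^'b"
  obtains k where "0 \<le> k" "\<And>v. norm (L *v v) \<le> k * norm v"
  using onorm[OF matrix_vector_mul_bounded_linear[of L]]
    onorm_pos_le[OF matrix_vector_mul_bounded_linear[of L]] that by blast

text \<open>For symmetric \<open>P\<close> the matrix is the Gram matrix of
  \<open>transpose B ** P\<close>. This yields both the nonnegativity and the quadratic upper bound
  that \<open>attacked_loop\<close> asks of \<open>\<Gamma>\<close>.\<close>

lemma quad_gram: "quad (P ** B ** transpose B ** P) v = (norm (transpose B *v (P *v v)))\<^sup>2"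
  if "transpose P = P" for P :: "real^'n^'n" and B :: "real^'m^'n"
proof -
  have "quad (P ** B ** transpose B ** P) v = v \<bullet> (P *v (B *v (transpose B *v (P *v v))))"
    by (simp add: quad_def matrix_vector_mul_assoc matrix_mul_assoc)
  also have "\<dots> = (transpose B *v (P *v v)) \<bullet> (transpose B *v (P *v v))"
    using that by (metis dot_lmul_matrix vector_transpose_matrix transpose_transpose matrix_vector_mul_assoc)
  finally show ?thesis
    by (simp add: power2_norm_eq_inner)
qed

text \<open>Since \<open>\<delta>\<^sup>2 \<le> \<delta>\<close> for \<open>\<delta>\<close> in
  \<open>(0, 1]\<close>, a step below all of the finitely many \<open>W i / (a i + 1)\<close> works;
  adding 1 admits \<open>a i = 0\<close> and makes the inequality strict.\<close>

lemma uniform_step: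
  fixes a W :: "'i::finite \<Rightarrow> real"
  assumes "\<And>i. 0 \<le> a i" "\<And>i. 0 < W i"
  obtains \<delta> where "0 < \<delta>" "\<delta> \<le> 1" "\<And>i. a i * \<delta>\<^sup>2 < W i"
proof -
  define f where "f i = W i / (a i + 1)" for i
  define \<delta> where "\<delta> = min 1 (Min (range f))"
  have f: "0 < f i" for i
    using assms[of i] by (simp add: f_def add_nonneg_pos)
  then have "0 < \<delta>" "\<delta> \<le> 1"
    by (auto simp: \<delta>_def)
  moreover have "a i * \<delta>\<^sup>2 < W i" for i
  proof -
    have "\<delta> \<le> f i"
      by (auto simp: \<delta>_def intro: min.coboundedI2)
    have "\<delta>\<^sup>2 \<le> \<delta>"
      using \<open>0 < \<delta>\<close> \<open>\<delta> \<le> 1\<close> by (simp add: power2_eq_square mult_left_le)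
    then have "a i * \<delta>\<^sup>2 \<le> a i * f i"
      using assms(1)[of i] \<open>\<delta> \<le> f i\<close> by (intro mult_left_mono) auto
    also have "\<dots> < (a i + 1) * f i"
      using f[of i] by (simp add: algebra_simps)
    also have "\<dots> = W i"
      using assms(1)[of i] by (simp add: f_def add_nonneg_eq_0_iff)
    finally show ?thesis .
  qed
  ultimately show ?thesis using that by blast
qed

section \<open>From sample paths to almost sure statements\<close>

theorem theorem2:
  fixes M :: "'w measure"
    and A :: "real^'n^'n" and B :: "real^'m^'n" and C :: "real^'n^'y" and G :: "real^'y^'n"
    and K :: "real^'n^'m" and P Q \<Gamma> \<Psi> :: "real^'n^'n"
    and E :: "'s::finite \<Rightarrow> 'N::finite \<Rightarrow> 'N \<Rightarrow> bool"
    and \<Upsilon> :: "real^'s^'s" and \<pi> :: "real^'s" and Lhat F :: "real^'N^'N"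
    and \<sigma> :: "real \<Rightarrow> 'w \<Rightarrow> 's"
    and \<alpha> :: "'N \<Rightarrow> real \<Rightarrow> 'w \<Rightarrow> real" and \<epsilon> :: "'w \<Rightarrow> real \<Rightarrow> real^'y^'N"
    and \<alpha>bar th \<upsilon> \<iota> \<eta> \<zeta> \<beta> dbar d0 w0 :: "'N \<Rightarrow> real"
    and x0 xh0 :: "'N \<Rightarrow> real^'n"
    and c \<kappa> chi \<tau> dmax ctil \<rho> \<pi>max \<pi>min s N :: real
    and T :: "'w \<Rightarrow> ereal"
    and x xh :: "'w \<Rightarrow> 'N \<Rightarrow> real \<Rightarrow> real^'n" and d w :: "'w \<Rightarrow> 'N \<Rightarrow> real \<Rightarrow> real"
    and t :: "'w \<Rightarrow> 'N \<Rightarrow> nat \<Rightarrow> ereal"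
  assumes "prob_space M"
    and "s = real CARD('s)" and "N = real CARD('N)" and "CARD('N) \<ge> 2"
    and "\<forall>p. undirected (E p)"
    and A1: "undirected (union_graph E)" "connected_graph (union_graph E)"
    and A2: "markov_process M \<sigma> \<Upsilon>" "ergodic \<Upsilon>" "invariant_distribution \<Upsilon> \<pi>"
      "\<forall>r\<ge>0. \<forall>p. measure M {\<omega> \<in> space M. \<sigma> r \<omega> = p} = \<pi> $ p"
    and A3: "\<tau> > 0" "\<forall>\<omega>\<in>space M. \<forall>r\<ge>0. (norm (\<epsilon> \<omega> r))\<^sup>2 \<le> \<tau>"
    and attack: "\<forall>i. \<forall>r\<ge>0. \<alpha> i r \<in> borel_measurable M \<and> (\<forall>\<omega>\<in>space M. \<alpha> i r \<omega> \<in> {0, 1}) \<and>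
      measure M {\<omega> \<in> space M. \<alpha> i r \<omega> = 1} = \<alpha>bar i"
    and "F = diag_mat \<alpha>bar"
    and "K = transpose B ** P" and "\<Gamma> = P ** B ** transpose B ** P"
    and "Lhat = (\<Sum>p\<in>UNIV. laplacian (E p))"
    and "\<pi>max = Max (range (($) \<pi>))" and "\<pi>min = Min (range (($) \<pi>))"
    and "dmax = Max (range dbar)" and "ctil = Max (range (\<lambda>i. dbar i + 4 * c))"
    and "\<rho> = ctil * \<pi>max * N * (N\<^sup>2 + N)"
    and "\<Psi> = (1 / s) *\<^sub>R (transpose A ** Q + Q ** A - Q ** G ** C - transpose (Q ** G ** C)
      + lambda_max (F ** transpose F) *\<^sub>R (Q ** G ** transpose G ** transpose Q)
      + (s * (2 * c + dmax\<^sup>2) * \<pi>max * (lambda_max Lhat)\<^sup>2) *\<^sub>R \<Gamma>)"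
    and "pos_def P" and "pos_def Q"
    and "c > 0" and "\<kappa> > 0" and "chi > 0"
    and "\<forall>i. 0 < th i \<and> th i < 1 \<and> \<upsilon> i > 0 \<and> \<iota> i > 0 \<and> \<eta> i > 0 \<and> \<zeta> i > 0 \<and>
      \<beta> i > 0 \<and> dbar i > 0"
    and init: "\<forall>i. w0 i > 0 \<and> 1 < d0 i \<and> d0 i < dbar i"
    and "neg_def (block_diag
        (\<pi>min *\<^sub>R (transpose A ** P + P ** A - (c / s * lambda2 Lhat) *\<^sub>R \<Gamma>)) \<Psi>
      + \<kappa> *\<^sub>R block_diag P Q)"
    and "neg_def (chi *\<^sub>R mat 1 - block_diag (lambda2 Lhat *\<^sub>R P) Q)"
    and "\<forall>i. \<rho> - \<zeta> i > 0 \<and> \<eta> i - (\<rho> - \<zeta> i) / \<iota> i > 0 \<and> dbar i > 4 * c + th i + 1 \<and>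
      \<upsilon> i \<ge> 1 / \<rho>"
    and "AE \<omega> in M. closed_loop A B C G K \<Gamma> E th \<upsilon> \<iota> \<eta> \<zeta> \<beta> dbar x0 xh0 d0 w0 (T \<omega>)
      (\<lambda>r. \<sigma> r \<omega>) (\<lambda>i r. \<alpha> i r \<omega>) (\<epsilon> \<omega>) (x \<omega>) (xh \<omega>) (d \<omega>) (w \<omega>) (t \<omega>)"
  shows "(AE \<omega> in M. \<forall>i. \<not> zeno (t \<omega> i)) \<and>
    (\<forall>b::real. \<exists>\<delta>>0. AE \<omega> in M. \<forall>i k. t \<omega> i k \<le> ereal b \<longrightarrow>
      t \<omega> i k + ereal \<delta> \<le> t \<omega> i (Suc k))"
proof -
  have P: "transpose P = P"
    using \<open>pos_def P\<close> by (simp add: pos_def_def)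
  obtain kA where kA: "0 \<le> kA" "\<And>v. norm (A *v v) \<le> kA * norm v"
    by (rule mat_vec_bound[of A]) blast
  obtain kB where kB: "0 \<le> kB" "\<And>v. norm ((B ** K) *v v) \<le> kB * norm v"
    by (rule mat_vec_bound[of "B ** K"]) blast
  obtain kC where kC: "0 \<le> kC" "\<And>v. norm ((G ** C) *v v) \<le> kC * norm v"
    by (rule mat_vec_bound[of "G ** C"]) blast
  obtain kG where kG: "0 \<le> kG" "\<And>v. norm (G *v v) \<le> kG * norm v"
    by (rule mat_vec_bound[of G]) blast
  obtain kH where kH: "0 \<le> kH" "\<And>v. norm ((transpose B ** P) *v v) \<le> kH * norm v"
    by (rule mat_vec_bound[of "transpose B ** P"]) blast
  have \<Gamma>: "quad \<Gamma> v = (norm ((transpose B ** P) *v v))\<^sup>2" for v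
    using quad_gram[OF P, of B v] by (simp add: \<open>\<Gamma> = _\<close> matrix_vector_mul_assoc)
  \<comment> \<open>The summand 1 provides both \<open>1 \<le> R\<close> and strict bounds on all
    initial states.\<close>
  define R where "R = 1 + (\<Sum>i\<in>UNIV. norm (x0 i) + norm (xh0 i))"
  have R: "norm (x0 i) + norm (xh0 i) < R" for i
    using member_le_sum[of i UNIV "\<lambda>i. norm (x0 i) + norm (xh0 i)"] by (simp add: R_def)
  have "1 \<le> R"
    by (simp add: R_def sum_nonneg)
  \<comment> \<open>The value of \<open>growth\<close>, written down before any sample path is
    fixed, so that the step chosen from it depends neither on \<open>\<omega>\<close> nor on
    \<open>T \<omega>\<close>.\<close>
  define g where "g = kA + dmax * (kB * (2 * real CARD('N))) + 2 * kC + kG * sqrt \<tau>"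
  have loop: "AE \<omega> in M. attacked_loop A B C G K \<Gamma> E th \<upsilon> \<iota> \<eta> \<zeta> \<beta> dbar x0 xh0 d0 w0 (T \<omega>)
      (\<lambda>r. \<sigma> r \<omega>) (\<lambda>i r. \<alpha> i r \<omega>) (\<epsilon> \<omega>) (x \<omega>) (xh \<omega>) (d \<omega>) (w \<omega>) (t \<omega>)
      kA kB kC kG (kH\<^sup>2) dmax (sqrt \<tau>)"
    using \<open>AE \<omega> in M. closed_loop _ _ _ _ _ _ _ _ _ _ _ _ _ _ _ _ _ _ _ _ _ _ _ _ _ _ _\<close> AE_space
  proof eventually_elim
    case (elim \<omega>)
    show ?case
    proof
      show "quad \<Gamma> v \<le> kH\<^sup>2 * (norm v)\<^sup>2" for v
        using power_mono[OF kH(2)[of v], of 2] by (simp add: \<Gamma> power_mult_distrib)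
      show "norm (\<epsilon> \<omega> r) \<le> sqrt \<tau>" if "0 \<le> r" for r
        using A3 elim(2) that by (simp add: real_le_rsqrt)
      show "dbar i \<le> dmax" for i
        by (simp add: \<open>dmax = _\<close>)
      show "norm (B *v (K *v v)) \<le> kB * norm v" for v
        using kB(2)[of v] by (simp add: matrix_vector_mul_assoc)
      show "norm (G *v (C *v v)) \<le> kC * norm v" for v
        using kC(2)[of v] by (simp add: matrix_vector_mul_assoc)
      show "0 \<le> d0 i" "d0 i \<le> dbar i" "0 < w0 i" for i
        using spec[OF init, of i] by linarith+
      show "\<alpha> i r \<omega> \<in> {0, 1}" if "0 \<le> r" for i r
        using attack elim(2) that by blast
    qed (use elim kA kC kB kG \<open>\<forall>i. 0 < th i \<and> _ i\<close> in \<open>auto simp: \<Gamma> less_imp_le\<close>)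
  qed
  have separated: "\<exists>\<delta>>0. AE \<omega> in M. \<forall>i k. t \<omega> i k \<le> ereal b \<longrightarrow>
      t \<omega> i k + ereal \<delta> \<le> t \<omega> i (Suc k)" for b
  proof -
    \<comment> \<open>A speed bound for the observer states up to time \<open>b + 1\<close>;
      \<open>\<delta>\<close> is then chosen against the threshold bounds at that time, for all
      agents at once.\<close>
    define V where "V = g * (R * exp (g * (b + 1)))"
    obtain \<delta> where \<delta>: "0 < \<delta>" "\<delta> \<le> 1"
        "\<And>i. \<iota> i * (kH\<^sup>2 * V\<^sup>2) * \<delta>\<^sup>2 < w0 i * exp (- (\<eta> i + \<zeta> i / \<iota> i) * (b + 1))"
      by (rule uniform_step[of "\<lambda>i. \<iota> i * (kH\<^sup>2 * V\<^sup>2)"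
            "\<lambda>i. w0 i * exp (- (\<eta> i + \<zeta> i / \<iota> i) * (b + 1))"])
         (use init \<open>\<forall>i. 0 < th i \<and> _ i\<close> in \<open>auto simp: less_imp_le\<close>)
    from loop have "AE \<omega> in M. \<forall>i k. t \<omega> i k \<le> ereal b \<longrightarrow> t \<omega> i k + ereal \<delta> \<le> t \<omega> i (Suc k)"
    proof eventually_elim
      case (elim \<omega>)
      interpret attacked_loop A B C G K \<Gamma> E th \<upsilon> \<iota> \<eta> \<zeta> \<beta> dbar x0 xh0 d0 w0 "T \<omega>"
        "\<lambda>r. \<sigma> r \<omega>" "\<lambda>i r. \<alpha> i r \<omega>" "\<epsilon> \<omega>" "x \<omega>" "xh \<omega>" "d \<omega>" "w \<omega>" "t \<omega>"
        kA kB kC kG "kH\<^sup>2" dmax "sqrt \<tau>"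
        by (fact elim)
      have R': "norm (x0 i) < R" "norm (xh0 i) < R" for i
        using R[of i] by (smt (verit) norm_ge_zero)+
      have "growth = g"
        by (simp add: growth_def g_def)
      then have "\<iota> i * (kH\<^sup>2 * (growth * (R * exp (growth * (b + 1))) * \<delta>)\<^sup>2)
          < w0 i * exp (- (\<eta> i + \<zeta> i / \<iota> i) * (b + 1))" for i
        using \<delta>(3)[of i] by (simp add: V_def power_mult_distrib mult_ac)
      from inter_event_time[OF \<open>1 \<le> R\<close> R' \<delta>(1,2) this] show ?case
        by (intro allI impI)
    qed
    with \<delta>(1) show ?thesis by blast
  qed
  moreover have "AE \<omega> in M. \<forall>i. \<not> zeno (t \<omega> i)"
  proof -
    \<comment> \<open>The exceptional null set may depend on the horizon. Restricting to natural
      horizons and choosing one step for each leaves countably many null sets, whose union is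
      null.\<close>
    have "\<forall>n::nat. \<exists>\<delta>. 0 < \<delta> \<and> (AE \<omega> in M. \<forall>i k. t \<omega> i k \<le> ereal n \<longrightarrow>
        t \<omega> i k + ereal \<delta> \<le> t \<omega> i (Suc k))"
      using separated by (intro allI)
    from choice[OF this] obtain \<delta> :: "nat \<Rightarrow> real" where \<delta>: "\<forall>n. 0 < \<delta> n \<and> (AE \<omega> in M. \<forall>i k. t \<omega> i k \<le> ereal n \<longrightarrow>
        t \<omega> i k + ereal (\<delta> n) \<le> t \<omega> i (Suc k))" ..
    have "AE \<omega> in M. \<forall>n::nat. \<forall>i k. t \<omega> i k \<le> ereal n \<longrightarrow> t \<omega> i k + ereal (\<delta> n) \<le> t \<omega> i (Suc k)"
      by (rule AE_all_countable[THEN iffD2]) (use \<delta> in blast)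
    with loop show ?thesis
    proof eventually_elim
      case (elim \<omega>)
      interpret attacked_loop A B C G K \<Gamma> E th \<upsilon> \<iota> \<eta> \<zeta> \<beta> dbar x0 xh0 d0 w0 "T \<omega>"
        "\<lambda>r. \<sigma> r \<omega>" "\<lambda>i r. \<alpha> i r \<omega>" "\<epsilon> \<omega>" "x \<omega>" "xh \<omega>" "d \<omega>" "w \<omega>" "t \<omega>"
        kA kB kC kG "kH\<^sup>2" dmax "sqrt \<tau>"
        by (fact elim(1))
      show ?case
      proof
        fix i
        show "\<not> zeno (t \<omega> i)"
        proof (rule not_zeno_if_separated)
          show "incseq (t \<omega> i)" by (simp add: monoI t_mono)
          show "t \<omega> i 0 = 0" by (rule init)
          show "\<exists>\<delta>>0. \<forall>k. t \<omega> i k \<le> ereal n \<longrightarrow> t \<omega> i k + ereal \<delta> \<le> t \<omega> i (Suc k)" for n :: nat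
            using spec[OF elim(2), of n] spec[OF \<delta>, of n] by blast
        qed
      qed
    qed
  qed
  ultimately show ?thesis by blast
qed

end
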